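(* Let $r\ge4$ be even. The only feasible parameter set $(n,r,c)$ for an abelian drackn corresponding to a set of real equiangular lines of maximum size in dimension $\overline{m_\tau}$ is $(28,4,8)$. That is, for positive integers $n,r,c$ with $r\ge 4$ even: $(n,r,c)$ is feasible and satisfies $n=\binom{\overline{m_\tau}+1}{2}$ if and only if $(n,r,c)=(28,4,8)$.
   Context: An $(n,r,c)$-drackn is an antipodal distance-regular graph of diameter $3$ that is an $r$-fold cover of $K_n$ (vertex set partitioned into $n$ fibres of size $r$, no edges inside fibres, a perfect matching between any two fibres), whose antipodal classes are the fibres and in which vertices at distance two have $c$ common neighbours. It is abelian if it is determined by a normalized arc function (permutation voltage assignment, equal to the identity on a spanning tree) whose values generate an abelian group acting regularly on the $r$ points of a fibre. An abelian drackn with $r$ even yields $n$ real equiangular lines in dimension $\overline{m_\tau}$; "maximum size" means that the absolute bound $n\le\binom{d+1}{2}$ holds with equality for $d=\overline{m_\tau}$. For integers $n\ge2$, $r\ge2$, $c\ge1$ put $\delta=n-rc-2$, $\theta=\frac{\delta+\sqrt{\delta^2+4(n-1)}}{2}$, $\tau=\frac{\delta-\sqrt{\delta^2+4(n-1)}}{2}$, $m_\theta=\frac{n(r-1)\tau}{\tau-\theta}$, $m_\tau=\frac{n(r-1)\theta}{\theta-\tau}$, $\overline{m_\theta}=m_\theta/(r-1)$, $\overline{m_\tau}=m_\tau/(r-1)$. The parameter set $(n,r,c)$ is feasible (for an abelian drackn) if $n\ge2$, $r\ge2$, $c\ge1$ and all of the following hold: (a) $1\le c(r-1)\le n-2\le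 c(2r-1)-2$. (b) $m_\theta$ and $m_\tau$ are integers. (c) If $\delta\ne0$, then $\theta$ and $\tau$ are integers. (d) If $\delta=0$, then $\theta=-\tau=\sqrt{n-1}$. (e) If $n$ is even, then $c$ is even. (f) If $c=1$, then $(n-r)$ divides $n-1$, $(n-r)(n-r+1)$ divides $rn(n-1)$, and $(n-r)^2\le n-1$. (g) If $r>2$, then $\theta^3\ge n-1$. (h) Suppose $\theta\ne1$, $\tau\ne-1$ and $\theta^3\ne n-1$. If $r>2$, then $rn\le\frac12m_\theta(m_\theta+1)$ and $rn\le\frac12m_\tau(m_\tau+1)$. If $r=2$, then $n\le\frac12m_\theta(m_\theta+1)$ and $n\le\frac12m_\tau(m_\tau+1)$. (i) If $r>2$, $\beta\in\{\theta,\tau\}$ is an integer, and $n>m_\beta-r+3$, then $\beta+1$ divides $c$. (j) Any odd prime that divides $r$ also divides $n$. *)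

theory Defs
  imports Complex_Main "HOL-Computational_Algebra.Primes"
begin

text \<open>
  Parameters are of type \<^typ>\<open>int\<close>, so that no subtraction truncates.
  The eigenvalues and multiplicities are real-valued; their integrality is part
  of feasibility.
\<close>

definition drackn_delta :: "int \<Rightarrow> int \<Rightarrow> int \<Rightarrow> int" where
  "drackn_delta n r c = n - r * c - 2"

definition drackn_theta :: "int \<Rightarrow> int \<Rightarrow> int \<Rightarrow> real" where
  "drackn_theta n r c =
     (drackn_delta n r c + sqrt ((drackn_delta n r c)\<^sup>2 + 4 * (n - 1))) / 2"

definition drackn_tau :: "int \<Rightarrow> int \<Rightarrow> int \<Rightarrow> real" where
  "drackn_tau n r c =
     (drackn_delta n r c - sqrt ((drackn_delta n r c)\<^sup>2 + 4 * (n - 1))) / 2"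

definition mult_theta :: "int \<Rightarrow> int \<Rightarrow> int \<Rightarrow> real" where
  "mult_theta n r c =
     n * (r - 1) * drackn_tau n r c / (drackn_tau n r c - drackn_theta n r c)"

definition mult_tau :: "int \<Rightarrow> int \<Rightarrow> int \<Rightarrow> real" where
  "mult_tau n r c =
     n * (r - 1) * drackn_theta n r c / (drackn_theta n r c - drackn_tau n r c)"

definition mbar_theta :: "int \<Rightarrow> int \<Rightarrow> int \<Rightarrow> real" where
  "mbar_theta n r c = mult_theta n r c / (r - 1)"

definition mbar_tau :: "int \<Rightarrow> int \<Rightarrow> int \<Rightarrow> real" where
  "mbar_tau n r c = mult_tau n r c / (r - 1)"

definition feasible :: "int \<Rightarrow> int \<Rightarrow> int \<Rightarrow> bool" where
  "feasible n r c \<longleftrightarrow>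
    (let \<delta> = drackn_delta n r c;
         \<theta> = drackn_theta n r c; \<tau> = drackn_tau n r c;
         m\<^sub>\<theta> = mult_theta n r c; m\<^sub>\<tau> = mult_tau n r c
     in n \<ge> 2 \<and> r \<ge> 2 \<and> c \<ge> 1
      \<and> (1 \<le> c * (r - 1) \<and> c * (r - 1) \<le> n - 2 \<and> n - 2 \<le> c * (2 * r - 1) - 2)
      \<and> (m\<^sub>\<theta> \<in> \<int> \<and> m\<^sub>\<tau> \<in> \<int>)
      \<and> (\<delta> \<noteq> 0 \<longrightarrow> \<theta> \<in> \<int> \<and> \<tau> \<in> \<int>)
      \<and> (\<delta> = 0 \<longrightarrow> \<theta> = - \<tau> \<and> - \<tau> = sqrt (n - 1))
      \<and> (even n \<longrightarrow> even c)
      \<and> (c = 1 \<longrightarrow> (n - r) dvd (n - 1)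
                 \<and> (n - r) * (n - r + 1) dvd r * n * (n - 1)
                 \<and> (n - r)\<^sup>2 \<le> n - 1)
      \<and> (r > 2 \<longrightarrow> \<theta> ^ 3 \<ge> n - 1)
      \<and> (\<theta> \<noteq> 1 \<and> \<tau> \<noteq> -1 \<and> \<theta> ^ 3 \<noteq> n - 1 \<longrightarrow>
           (r > 2 \<longrightarrow> r * n \<le> 1 / 2 * m\<^sub>\<theta> * (m\<^sub>\<theta> + 1) \<and> r * n \<le> 1 / 2 * m\<^sub>\<tau> * (m\<^sub>\<tau> + 1))
         \<and> (r = 2 \<longrightarrow> n \<le> 1 / 2 * m\<^sub>\<theta> * (m\<^sub>\<theta> + 1) \<and> n \<le> 1 / 2 * m\<^sub>\<tau> * (m\<^sub>\<tau> + 1)))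
      \<and> (r > 2 \<longrightarrow> (\<forall>(\<beta>, m\<^sub>\<beta>) \<in> {(\<theta>, m\<^sub>\<theta>), (\<tau>, m\<^sub>\<tau>)}. \<forall>b::int.
           \<beta> = of_int b \<and> n > m\<^sub>\<beta> - r + 3 \<longrightarrow> (b + 1) dvd c))
      \<and> (\<forall>p::int. prime p \<and> odd p \<and> p dvd r \<longrightarrow> p dvd n))"

end

theory Submission
  imports Defs
begin

text \<open>
  Equality in the absolute bound forces \<open>\<theta>\<^sup>2 = d + 2\<close> for \<open>d = mbar_tau n r c\<close>, so that
  \<open>n - 1 = \<theta>\<^sup>2 (\<theta>\<^sup>2 - 3) / 2\<close> and \<open>r c = (\<theta> - 2) (\<theta> + 1)\<^sup>3 / 2\<close>. If \<open>\<delta> = 0\<close>, then \<open>\<theta>\<^sup>2 = 5\<close>,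
  which gives \<open>(6, 4, 1)\<close> and violates condition (e). Otherwise \<open>\<theta>\<close> is an integer, and
  \<open>\<theta>\<^sup>3 \<ge> n - 1\<close> together with \<open>r c > 0\<close> leaves only \<open>\<theta> = 3\<close>; then \<open>n = 28\<close>, \<open>r c = 32\<close>,
  and condition (a) gives \<open>c \<ge> 6\<close>.
\<close>

lemma drackn_theta_plus_tau: "drackn_theta n r c + drackn_tau n r c = drackn_delta n r c"
  by (simp add: drackn_theta_def drackn_tau_def field_simps)

text \<open>Vieta: the eigenvalues are the roots of x^2 - \<delta> x - (n - 1). The bound on
  \<open>n\<close> makes the radicand nonnegative, so that squaring the root recovers it.\<close>

lemma drackn_theta_times_tau:
  assumes "n \<ge> 1"
  shows "drackn_theta n r c * drackn_tau n r c = 1 - n"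
proof -
  define s where "s = sqrt ((drackn_delta n r c)\<^sup>2 + 4 * (n - 1))"
  have "s\<^sup>2 = (drackn_delta n r c)\<^sup>2 + 4 * (n - 1)"
    unfolding s_def using assms by simp
  then show ?thesis
    unfolding drackn_theta_def drackn_tau_def s_def[symmetric]
    by (simp add: field_simps power2_eq_square)
qed

lemma drackn_theta_pos:
  assumes "n \<ge> 2"
  shows "drackn_theta n r c > 0"
proof -
  have "\<bar>real_of_int (drackn_delta n r c)\<bar> < sqrt ((drackn_delta n r c)\<^sup>2 + 4 * (n - 1))"
    using assms by (intro real_less_rsqrt) simp
  then show ?thesis
    unfolding drackn_theta_def by (simp add: abs_less_iff)
qed

lemma drackn_tau_neg:
  assumes "n \<ge> 2"
  shows "drackn_tau n r c < 0"
proof -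
  have "drackn_theta n r c * drackn_tau n r c < 0"
    using drackn_theta_times_tau[of n r c] assms by simp
  then show ?thesis
    using drackn_theta_pos[OF assms, of r c] by (simp add: mult_less_0_iff)
qed

text \<open>The dimension \<open>mbar_tau\<close> is real-valued, so the absolute bound needs the
  generalized binomial coefficient.\<close>

lemma gchoose_two: "(x + 1) gchoose 2 = (x + 1) * x / 2" for x :: real
  by (simp add: gbinomial_prod_rev numeral_2_eq_2)

text \<open>Comparing d (\<theta> - \<tau>) = n \<theta> with n = d (d + 1) / 2 expresses \<tau>
  through \<theta> and \<open>d\<close>; the product of the eigenvalues then fixes \<open>d\<close>,
  leaving \<theta> as the only free parameter.\<close>

lemma max_equiangular_drackn_params:
  fixes n r c :: int
  assumes n: "n \<ge> 2" and r: "r \<ge> 2"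
    and max: "of_int n = (mbar_tau n r c + 1) gchoose 2"
  defines "\<theta> \<equiv> drackn_theta n r c"
  shows "n = (\<theta>\<^sup>2 - 2) * (\<theta>\<^sup>2 - 1) / 2"
    and "drackn_delta n r c = \<theta> * (5 - \<theta>\<^sup>2) / 2"
    and "r * c = (\<theta> - 2) * (\<theta> + 1) ^ 3 / 2"
proof -
  define \<tau> where "\<tau> = drackn_tau n r c"
  define d where "d = mbar_tau n r c"
  have sum: "\<theta> + \<tau> = drackn_delta n r c"
    unfolding \<theta>_def \<tau>_def by (rule drackn_theta_plus_tau)
  have prod: "\<theta> * \<tau> = 1 - n"
    unfolding \<theta>_def \<tau>_def using n by (intro drackn_theta_times_tau) simp
  have signs: "\<theta> > 0" "\<tau> < 0"
    unfolding \<theta>_def \<tau>_def using drackn_theta_pos drackn_tau_neg n by auto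
  have nd: "real_of_int n = (d + 1) * d / 2"
    using max unfolding d_def gchoose_two .
  have "d = n * \<theta> / (\<theta> - \<tau>)"
    using r unfolding d_def mbar_tau_def mult_tau_def \<theta>_def \<tau>_def by simp
  then have "d * (\<theta> - \<tau>) = n * \<theta>"
    using signs by simp
  then have "d * (\<theta> - \<tau>) = d * ((d + 1) * \<theta> / 2)"
    unfolding nd by simp
  moreover have "d \<noteq> 0"
    using nd n by auto
  ultimately have "\<theta> - \<tau> = (d + 1) * \<theta> / 2"
    using mult_left_cancel by blast
  then have tau: "\<tau> = - (\<theta> * (d - 1) / 2)"
    by (simp add: field_simps)
  \<comment> \<open>Both sides equal 2 (n - 1). The factor d - 1 cancels, since d = 1 would give n =
    1.\<close>
  have "(d - 1) * \<theta>\<^sup>2 = (d - 1) * (d + 2)"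
    using prod nd unfolding tau by (simp add: field_simps power2_eq_square)
  moreover have "d \<noteq> 1"
    using nd n by auto
  ultimately have d: "d = \<theta>\<^sup>2 - 2"
    by simp
  show n_eq: "n = (\<theta>\<^sup>2 - 2) * (\<theta>\<^sup>2 - 1) / 2"
    unfolding nd d by simp
  show delta: "drackn_delta n r c = \<theta> * (5 - \<theta>\<^sup>2) / 2"
    unfolding sum[symmetric] tau d by (simp add: field_simps)
  have "real_of_int (r * c) = n - 2 - drackn_delta n r c"
    unfolding drackn_delta_def by simp
  also have "\<dots> = (\<theta> - 2) * (\<theta> + 1) ^ 3 / 2"
    using n_eq delta by (simp add: field_simps power2_eq_square power3_eq_cube)
  finally show "r * c = (\<theta> - 2) * (\<theta> + 1) ^ 3 / 2" .
qed

lemma max_equiangular_drackn_imp: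
  fixes n r c :: int
  assumes r4: "r \<ge> 4" and feas: "feasible n r c"
    and max: "of_int n = (mbar_tau n r c + 1) gchoose 2"
  shows "(n, r, c) = (28, 4, 8)"
proof -
  define \<theta> where "\<theta> = drackn_theta n r c"
  have n2: "n \<ge> 2" and c1: "c \<ge> 1" and a: "c * (r - 1) \<le> n - 2"
    and int: "drackn_delta n r c \<noteq> 0 \<Longrightarrow> \<theta> \<in> \<int>" and ev: "even n \<Longrightarrow> even c"
    and cube: "\<theta> ^ 3 \<ge> n - 1"
    using feas r4 unfolding feasible_def \<theta>_def by (simp_all add: Let_def)
  have pos: "\<theta> > 0"
    unfolding \<theta>_def using n2 by (rule drackn_theta_pos)
  have "r \<ge> 2" using r4 by simp
  note params = max_equiangular_drackn_params[OF n2 this max, folded \<theta>_def]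
  have rc4: "r * c \<ge> 4 * c"
    using r4 c1 by simp
  show ?thesis
  proof (cases "drackn_delta n r c = 0")
    case True
    then have "\<theta>\<^sup>2 = 5"
      using params(2) pos by simp
    then have "n = 6"
      using params(1) by simp
    moreover from this have "r * c = 4"
      using True unfolding drackn_delta_def by simp
    ultimately have "even c" "c \<le> 1"
      using ev rc4 by auto
    then show ?thesis
      using c1 by presburger
  next
    case False
    then obtain b :: int where b: "\<theta> = b"
      using int by (auto elim: Ints_cases)
    have "(\<theta> - 2) * (\<theta> + 1) ^ 3 / 2 > 0"
      unfolding params(3)[symmetric] using rc4 c1 by linarith
    then have gt2: "\<theta> > 2"
      using pos by (simp add: zero_less_mult_iff)
    \<comment> \<open>Factoring the gap in condition (g) turns it into an upper bound on
      \<theta>.\<close>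
    have "\<theta>\<^sup>2 * ((\<theta> - 3) * (\<theta> + 1)) = 2 * (n - 1 - \<theta> ^ 3)"
      using params(1) by (simp add: field_simps power2_eq_square power3_eq_cube)
    then have "\<theta>\<^sup>2 * ((\<theta> - 3) * (\<theta> + 1)) \<le> 0"
      using cube by simp
    then have "\<theta> \<le> 3"
      using pos by (simp add: mult_le_0_iff)
    with gt2 have th: "\<theta> = 3"
      unfolding b by simp
    have n: "n = 28"
      using params(1) unfolding th by simp
    have "real_of_int (r * c) = 32"
      using params(3) unfolding th by simp
    then have rc: "r * c = 32"
      by linarith
    \<comment> \<open>Condition (a) reads 32 - c \<le> 26, and r \<ge> 4 gives 4 c \<le> 32. Of 6,
      7, 8 only 8 divides 32.\<close>
    have "c \<ge> 6" "c \<le> 8"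
      using a rc rc4 n by (simp_all add: algebra_simps)
    then have "c = 6 \<or> c = 7 \<or> c = 8"
      by auto
    then have "c = 8" "r = 4"
      using rc by (auto; presburger)+
    with n show ?thesis
      by simp
  qed
qed

lemma drackn_28_4_8:
  shows "drackn_delta 28 4 8 = -6"
    and "drackn_theta 28 4 8 = 3"
    and "drackn_tau 28 4 8 = -9"
    and "mult_theta 28 4 8 = 63"
    and "mult_tau 28 4 8 = 21"
    and "mbar_tau 28 4 8 = 7"
proof -
  show delta: "drackn_delta 28 4 8 = -6"
    by (simp add: drackn_delta_def)
  \<comment> \<open>The radicand is 36 + 4 * 27.\<close>
  have "sqrt 144 = 12"
    by (rule real_sqrt_unique) simp_all
  then show theta: "drackn_theta 28 4 8 = 3" and tau: "drackn_tau 28 4 8 = -9"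
    by (simp_all add: drackn_theta_def drackn_tau_def delta)
  show "mult_theta 28 4 8 = 63" and mtau: "mult_tau 28 4 8 = 21"
    by (simp_all add: mult_theta_def mult_tau_def theta tau)
  show "mbar_tau 28 4 8 = 7"
    by (simp add: mbar_tau_def mtau)
qed

lemma feasible_28_4_8: "feasible 28 4 8"
proof -
  have "p dvd 28" if "prime p" "odd p" "p dvd 4" for p :: int
  proof -
    have "p dvd 2 ^ 2"
      using that by simp
    then have "p dvd 2"
      using \<open>prime p\<close> prime_dvd_power by blast
    then have "p = 2"
      using \<open>prime p\<close> by (simp add: primes_dvd_imp_eq)
    then show ?thesis
      using \<open>odd p\<close> by simp
  qed
  \<comment> \<open>In condition (i) the multiplicity threshold is 62 for \<theta> and 20 for
    \<tau>; as n = 28, only \<tau> = -9 demands a divisibility.\<close>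
  moreover have "(b + 1) dvd 8" if "- 9 = real_of_int b" for b :: int
  proof -
    have "b = -9" using that by linarith
    then show ?thesis by simp
  qed
  ultimately show ?thesis
    unfolding feasible_def drackn_28_4_8 Let_def by auto
qed

theorem theorem6p6:
  fixes n r c :: int
  assumes "n > 0" and "c > 0" and "r \<ge> 4" and "even r"
  shows "feasible n r c \<and> of_int n = (mbar_tau n r c + 1) gchoose 2
         \<longleftrightarrow> (n, r, c) = (28, 4, 8)"
proof
  assume "feasible n r c \<and> of_int n = (mbar_tau n r c + 1) gchoose 2"
  then show "(n, r, c) = (28, 4, 8)"
    using max_equiangular_drackn_imp \<open>r \<ge> 4\<close> by blast
next
  assume "(n, r, c) = (28, 4, 8)"
  then show "feasible n r c \<and> of_int n = (mbar_tau n r c + 1) gchoose 2"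
    using feasible_28_4_8 gchoose_two[of 7] by (simp add: drackn_28_4_8)
qed

end
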